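(* Let $p\in\mathbb{R}^n$. If $h\in\mathcal{P}(\{p\})$ and, for some $x\in(\mathbb{R}^+)^n$, $h'(p)[x]$ exists, then $h'(p)[1]$ exists and $$|h'(p)[x]|\le\|x\|_\infty\,h'(p)[1].$$
   Context: $\Pi=\{z\in\mathbb{C}:\operatorname{Im}z>0\}$, $\mathbb{R}^+=(0,\infty)$, and $1$ as a direction denotes $(1,1,\dots,1)\in\mathbb{R}^n$. For $E\subseteq\mathbb{R}^n$, the Pick class $\mathcal{P}(E)$ is the set of all functions $f:\Pi^n\cup E\to\overline{\Pi}$ such that $f$ is analytic on $\Pi^n$ and continuous on $\Pi^n\cup E$. For $v\in(\mathbb{R}^+)^n$, $h'(p)[v]$ denotes the directional derivative of $h$ at the boundary point $p$, $h'(p)[v]=\lim_{s\to0^+}\frac{h(p+isv)-h(p)}{is}$, and it exists when this limit exists and is finite.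
   Formalization: The formal theorem additionally assumes that h(p) is real; without this the claim fails, e.g. for h(z) = -1/(z_1+i), p = 0, x = 1, where h(0) = i and h'(0)[1] = -1. *)

theory Defs
  imports "HOL-Analysis.Analysis"
begin

definition upper_half_plane :: "complex set" where
  "upper_half_plane = {z. Im z > 0}"

definition upper_poly_half_plane :: "(complex ^ 'n) set" where
  "upper_poly_half_plane = {z. \<forall>j. z $ j \<in> upper_half_plane}"

definition complex_vec :: "real ^ 'n \<Rightarrow> complex ^ 'n" where
  "complex_vec x = (\<chi> j. complex_of_real (x $ j))"

text \<open>
  Analyticity in several complex variables: around every point of the set, the function is the
  sum of a power series, indexed by the multi-indices \<open>\<alpha>\<close>, on some polydisc. Unordered
  (hence absolute) convergence makes an enumeration of the multi-indices unnecessary.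
\<close>

definition multi_analytic_on :: "(complex ^ 'n \<Rightarrow> complex) \<Rightarrow> (complex ^ 'n) set \<Rightarrow> bool"
    (infix "multi'_analytic'_on" 50) where
  "f multi_analytic_on S \<longleftrightarrow>
     (\<forall>a\<in>S. \<exists>r>0. \<exists>c :: ('n \<Rightarrow> nat) \<Rightarrow> complex.
        \<forall>z. (\<forall>j. norm (z $ j - a $ j) < r) \<longrightarrow>
          ((\<lambda>\<alpha>. c \<alpha> * (\<Prod>j\<in>UNIV. (z $ j - a $ j) ^ \<alpha> j)) has_sum f z) UNIV)"

text \<open>
  The members of the Pick class are total functions here; their values outside
  \<open>\<Pi>\<^sup>n \<union> E\<close> are unconstrained. Boundary values do
  not have to be real: \<open>z \<mapsto> - 1 / (z\<^sub>j + \<i>)\<close> lies in the Pick class of \<open>{0}\<close> and takes the value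
  \<open>\<i>\<close> at \<open>0\<close>, with directional derivative \<open>- v\<^sub>j\<close> there.
\<close>

definition pick_class :: "(real ^ 'n) set \<Rightarrow> (complex ^ 'n \<Rightarrow> complex) set" where
  "pick_class E =
     {f. f ` (upper_poly_half_plane \<union> complex_vec ` E) \<subseteq> closure upper_half_plane \<and>
         f multi_analytic_on upper_poly_half_plane \<and>
         continuous_on (upper_poly_half_plane \<union> complex_vec ` E) f}"

definition dir_quotient ::
    "(complex ^ 'n \<Rightarrow> complex) \<Rightarrow> real ^ 'n \<Rightarrow> real ^ 'n \<Rightarrow> real \<Rightarrow> complex" where
  "dir_quotient h p v s =
     (h (complex_vec p + (\<i> * complex_of_real s) *s complex_vec v) - h (complex_vec p))
       / (\<i> * complex_of_real s)"

definition has_dir_deriv :: "(complex ^ 'n \<Rightarrow> complex) \<Rightarrow> real ^ 'n \<Rightarrow> real ^ 'n \<Rightarrow> bool" where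
  "has_dir_deriv h p v \<longleftrightarrow> (\<exists>D. (dir_quotient h p v \<longlongrightarrow> D) (at_right 0))"

text \<open>Meaningful only if \<^term>\<open>has_dir_deriv h p v\<close>.\<close>

definition dir_deriv :: "(complex ^ 'n \<Rightarrow> complex) \<Rightarrow> real ^ 'n \<Rightarrow> real ^ 'n \<Rightarrow> complex" where
  "dir_deriv h p v = Lim (at_right 0) (dir_quotient h p v)"

end

theory Submission
  imports Defs "HOL-Complex_Analysis.Conformal_Mappings"
begin

text \<open>
  Everything follows from one inequality. For a holomorphic map \<open>h\<close> of \<open>\<Pi>\<^sup>n\<close> into the closed upper
  half plane, Schwarz--Pick on the polydisc, transported to half planes, reads
  \<open>\<bar>h z - h w\<bar>\<^sup>2 \<le> K Im (h z) Im (h w)\<close> whenever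
  \<open>\<bar>z\<^sub>j - w\<^sub>j\<bar>\<^sup>2 \<le> K Im z\<^sub>j Im w\<^sub>j\<close> for all \<open>j\<close>
  (\<open>Schwarz_Pick_upper_poly_half_plane\<close>). It follows from the one-variable Schwarz lemma on an
  analytic disc through \<open>w\<close> and \<open>z\<close>.

  Take \<open>z = p + isy\<close> and let \<open>w = p + itv\<close> run to \<open>p\<close>. The constant \<open>K\<close> blows up only like \<open>1 / t\<close>, so
  it is balanced by \<open>Im (h w) \<le> A t\<close>, and in the limit
  \<open>\<bar>h (p + isy) - h p\<bar>\<^sup>2 \<le> Im (h (p + isy)) A B s\<close> if \<open>y \<le> B v\<close> componentwise
  (\<open>Julia_along_rays\<close>, a form of Julia's lemma). As \<open>h p\<close> is real, the imaginary part on the right is at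
  most \<open>\<bar>h (p + isy) - h p\<bar>\<close>, which leaves the linear bound
  \<open>\<bar>h (p + isy) - h p\<bar> \<le> A B s\<close>. This bound is used three times.

  With \<open>v = x\<close> and \<open>y = 1\<close>: existence of \<open>h'(p)[x]\<close> bounds \<open>Im h (p + itx) / t\<close>, hence
  \<open>Im h (p + it1) / t\<close> is bounded as well.

  With \<open>v = y = 1\<close>: the supremum \<open>\<alpha>\<close> of \<open>\<bar>h (p + is1) - h p\<bar> / s\<close> is at most every \<open>A\<close> for which
  \<open>Im h (p + it1) \<le> A t\<close> for arbitrarily small \<open>t\<close>. So \<open>Im h (p + it1) / t\<close> tends to \<open>\<alpha>\<close>, which is
  Caratheodory's theorem (\<open>Caratheodory_along_ray\<close>): \<open>h'(p)[1] = \<alpha>\<close>.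

  With \<open>v = 1\<close> and \<open>y = x\<close>, where \<open>A = \<alpha>\<close> and \<open>B\<close> is the maximum norm of \<open>x\<close>: the difference quotients
  in direction \<open>x\<close> are bounded by \<open>\<alpha>\<close> times that norm, and so is their limit.
\<close>

section \<open>Analytic functions along holomorphic curves\<close>

text \<open>
  Near a point of the curve, the power series of \<open>f\<close> becomes a series of holomorphic functions of
  one variable. It converges uniformly on a small disc, because the Weierstrass test applies on every
  polydisc strictly inside the polydisc of convergence.
\<close>
lemma holomorphic_on_compose_multi_analytic:
  fixes f :: "complex ^ 'n \<Rightarrow> complex" and g :: "complex \<Rightarrow> complex ^ 'n"
  assumes f: "f multi_analytic_on S" and U: "open U"
    and g: "\<And>j. (\<lambda>\<zeta>. g \<zeta> $ j) holomorphic_on U" and gU: "g ` U \<subseteq> S"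
  shows "(\<lambda>\<zeta>. f (g \<zeta>)) holomorphic_on U"
proof -
  have "(\<lambda>\<zeta>. f (g \<zeta>)) field_differentiable at a" if a: "a \<in> U" for a
  proof -
    from a gU have "g a \<in> S" by auto
    then obtain r c where r: "r > 0" and c':
      "\<forall>z. (\<forall>j. norm (z $ j - g a $ j) < r) \<longrightarrow>
          ((\<lambda>\<alpha>. c \<alpha> * (\<Prod>j\<in>UNIV. (z $ j - g a $ j) ^ \<alpha> j)) has_sum f z) UNIV"
      using f unfolding multi_analytic_on_def by (elim ballE exE conjE) auto
    have c: "((\<lambda>\<alpha>. c \<alpha> * (\<Prod>j\<in>UNIV. (z $ j - g a $ j) ^ \<alpha> j)) has_sum f z) UNIV"
      if "\<And>j. norm (z $ j - g a $ j) < r" for z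
      using c' that by blast
    have "\<forall>\<^sub>F \<zeta> in nhds a. \<zeta> \<in> U"
      using U a by (rule eventually_nhds_in_open)
    moreover have "\<forall>\<^sub>F \<zeta> in nhds a. \<forall>j. dist (g \<zeta> $ j) (g a $ j) < r / 2"
    proof (rule eventually_all_finite)
      fix j
      have "isCont (\<lambda>\<zeta>. g \<zeta> $ j) a"
        using g[of j] U a holomorphic_on_imp_continuous_on continuous_on_eq_continuous_at by blast
      then have "filterlim (\<lambda>\<zeta>. g \<zeta> $ j) (nhds (g a $ j)) (nhds a)"
        unfolding isCont_def by (subst (asm) tendsto_at_iff_tendsto_nhds)
      then show "\<forall>\<^sub>F \<zeta> in nhds a. dist (g \<zeta> $ j) (g a $ j) < r / 2"
        using r by (intro tendstoD) auto
    qed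
    ultimately have "\<forall>\<^sub>F \<zeta> in nhds a. \<zeta> \<in> U \<and> (\<forall>j. dist (g \<zeta> $ j) (g a $ j) < r / 2)"
      by (rule eventually_conj)
    then obtain e where e: "e > 0"
      and eU: "\<And>\<zeta>. dist \<zeta> a < e \<Longrightarrow> \<zeta> \<in> U \<and> (\<forall>j. dist (g \<zeta> $ j) (g a $ j) < r / 2)"
      unfolding eventually_nhds_metric by blast
    define d where "d = e / 2"
    have d: "d > 0"
      using e by (simp add: d_def)
    have "dist \<zeta> a < e" if "\<zeta> \<in> cball a d" for \<zeta>
      using that e by (simp add: d_def dist_commute)
    with eU have dU: "cball a d \<subseteq> U"
      and dr: "\<And>\<zeta> j. \<zeta> \<in> cball a d \<Longrightarrow> norm (g \<zeta> $ j - g a $ j) \<le> r / 2"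
      by (auto simp: dist_norm less_imp_le)
    define T where "T = (\<lambda>\<alpha> \<zeta>. c \<alpha> * (\<Prod>j\<in>UNIV. (g \<zeta> $ j - g a $ j) ^ \<alpha> j))"
    define M where "M = (\<lambda>\<alpha>. norm (c \<alpha> * (\<Prod>j\<in>(UNIV::'n set). complex_of_real (r / 2) ^ \<alpha> j)))"
    \<comment> \<open>The majorant is the series itself at the point whose coordinates all differ from the
      centre by r / 2: there convergence is unconditional, hence absolute.\<close>
    have "M summable_on UNIV"
    proof -
      have "((\<lambda>\<alpha>. c \<alpha> * (\<Prod>j\<in>UNIV. ((\<chi> j. g a $ j + complex_of_real (r / 2)) $ j - g a $ j) ^ \<alpha> j))
               has_sum f (\<chi> j. g a $ j + complex_of_real (r / 2))) UNIV"
        using r by (intro c) simp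
      then have "(\<lambda>\<alpha>. c \<alpha> * (\<Prod>j\<in>(UNIV::'n set). complex_of_real (r / 2) ^ \<alpha> j)) summable_on UNIV"
        by (auto intro: has_sum_imp_summable)
      then show ?thesis
        unfolding M_def summable_on_iff_abs_summable_on_complex .
    qed
    moreover have "norm (T \<alpha> \<zeta>) \<le> M \<alpha>" if "\<zeta> \<in> cball a d" for \<alpha> \<zeta>
    proof -
      have "(\<Prod>j\<in>UNIV. norm (g \<zeta> $ j - g a $ j) ^ \<alpha> j) \<le> (\<Prod>j\<in>UNIV. (r / 2) ^ \<alpha> j)"
        using dr[OF that] by (intro prod_mono conjI power_mono) auto
      then show ?thesis
        using r by (simp add: T_def M_def norm_mult norm_power norm_divide mult_left_mono
            flip: prod_norm)
    qed
    moreover have "((\<lambda>\<alpha>. T \<alpha> \<zeta>) has_sum f (g \<zeta>)) UNIV" if "\<zeta> \<in> cball a d" for \<zeta>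
      unfolding T_def using dr[OF that] r by (intro c) (smt (verit) field_sum_of_halves)
    ultimately have lim: "uniform_limit (cball a d) (\<lambda>X \<zeta>. \<Sum>\<alpha>\<in>X. T \<alpha> \<zeta>) (\<lambda>\<zeta>. f (g \<zeta>))
        (finite_subsets_at_top UNIV)"
      by (intro Weierstrass_m_test_general')
    have "(\<lambda>\<zeta>. \<Sum>\<alpha>\<in>X. T \<alpha> \<zeta>) holomorphic_on cball a d" for X
      unfolding T_def using dU by (intro holomorphic_intros holomorphic_on_subset[OF g])
    then have partial_sums: "\<forall>\<^sub>F X in finite_subsets_at_top UNIV. continuous_on (cball a d) (\<lambda>\<zeta>. \<Sum>\<alpha>\<in>X. T \<alpha> \<zeta>) \<and>
        (\<lambda>\<zeta>. \<Sum>\<alpha>\<in>X. T \<alpha> \<zeta>) holomorphic_on ball a d"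
      by (intro always_eventually allI conjI)
        (auto intro: holomorphic_on_imp_continuous_on holomorphic_on_subset[OF _ ball_subset_cball])
    have "(\<lambda>\<zeta>. f (g \<zeta>)) holomorphic_on ball a d"
      by (rule holomorphic_uniform_limit[OF partial_sums lim finite_subsets_at_top_neq_bot])
    then show ?thesis
      using d by (intro holomorphic_on_imp_differentiable_at) auto
  qed
  then show ?thesis
    using U by (simp add: holomorphic_on_def field_differentiable_at_within)
qed

section \<open>The Schwarz--Pick inequality\<close>

text \<open>
  By this identity the pseudohyperbolic distance \<open>\<bar>z - w\<bar> / \<bar>z - cnj w\<bar>\<close> of the half plane is an
  increasing function of \<open>\<bar>z - w\<bar>\<^sup>2 / (Im z Im w)\<close>.
\<close>
lemma norm_diff_cnj_power2:
  "(norm (z - cnj w))\<^sup>2 = (norm (z - w))\<^sup>2 + 4 * Im z * Im w"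
  unfolding cmod_power2 by (simp add: power2_eq_square algebra_simps)

text \<open>
  The Schwarz lemma for \<open>F\<close> followed by the Cayley transform that sends \<open>F 0\<close> to \<open>0\<close>. Written without
  quotients, the inequality remains meaningful when \<open>F\<close> has real values; there it follows by applying
  the transform to \<open>F + i \<epsilon>\<close> and letting \<open>\<epsilon>\<close> tend to \<open>0\<close>.
\<close>
lemma Schwarz_Pick_disc_half_plane:
  assumes F: "F holomorphic_on ball 0 1" and Im: "\<And>\<zeta>. norm \<zeta> < 1 \<Longrightarrow> Im (F \<zeta>) \<ge> 0"
    and \<zeta>: "norm \<zeta> < 1"
  shows "(1 - (norm \<zeta>)\<^sup>2) * (norm (F \<zeta> - F 0))\<^sup>2 \<le> 4 * (norm \<zeta>)\<^sup>2 * Im (F \<zeta>) * Im (F 0)"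
proof -
  have eps: "(1 - (norm \<zeta>)\<^sup>2) * (norm (F \<zeta> - F 0))\<^sup>2
      \<le> 4 * (norm \<zeta>)\<^sup>2 * (Im (F \<zeta>) + \<epsilon>) * (Im (F 0) + \<epsilon>)" if \<epsilon>: "\<epsilon> > 0" for \<epsilon> :: real
  proof -
    define w where "w = F 0 + \<i> * of_real \<epsilon>"
    define G where "G = (\<lambda>u. F u + \<i> * of_real \<epsilon>)"
    have G: "Im (G u) > 0" if "norm u < 1" for u
      using Im[OF that] \<epsilon> by (simp add: G_def)
    have w: "Im w > 0" "w = G 0"
      using Im[of 0] \<epsilon> by (simp_all add: w_def G_def)
    have nz: "G u - cnj w \<noteq> 0" if "norm u < 1" for u
      using G[OF that] w by (auto simp: complex_eq_iff)
    have "norm ((\<lambda>u. (G u - w) / (G u - cnj w)) \<zeta>) \<le> norm \<zeta>"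
    proof (rule Schwarz_Lemma(1)[OF _ _ _ \<zeta>])
      show "(\<lambda>u. (G u - w) / (G u - cnj w)) holomorphic_on ball 0 1"
        using nz F unfolding G_def by (intro holomorphic_intros) auto
      show "(G 0 - w) / (G 0 - cnj w) = 0"
        by (simp add: w)
      fix u :: complex assume u: "norm u < 1"
      have "(norm (G u - w))\<^sup>2 < (norm (G u - cnj w))\<^sup>2"
        using G[OF u] w(1) by (simp add: norm_diff_cnj_power2)
      then have "norm (G u - w) < norm (G u - cnj w)"
        by (rule power2_less_imp_less) simp
      then show "norm ((G u - w) / (G u - cnj w)) < 1"
        using nz[OF u] by (simp add: norm_divide)
    qed
    then have "norm (G \<zeta> - w) \<le> norm \<zeta> * norm (G \<zeta> - cnj w)"
      using nz[OF \<zeta>] by (simp add: norm_divide field_simps)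
    then have "(norm (G \<zeta> - w))\<^sup>2 \<le> (norm \<zeta> * norm (G \<zeta> - cnj w))\<^sup>2"
      by (intro power_mono) auto
    also have "\<dots> = (norm \<zeta>)\<^sup>2 * ((norm (G \<zeta> - w))\<^sup>2 + 4 * Im (G \<zeta>) * Im w)"
      by (simp add: power_mult_distrib norm_diff_cnj_power2)
    finally show ?thesis
      by (simp add: G_def w_def algebra_simps)
  qed
  have "((\<lambda>\<epsilon>. 4 * (norm \<zeta>)\<^sup>2 * (Im (F \<zeta>) + \<epsilon>) * (Im (F 0) + \<epsilon>)) \<longlongrightarrow>
      4 * (norm \<zeta>)\<^sup>2 * (Im (F \<zeta>) + 0) * (Im (F 0) + 0)) (at_right 0)"
    by (intro tendsto_intros)
  then show ?thesis
    by (intro tendsto_lowerbound[where F = "at_right 0"])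
      (auto intro!: eps eventually_mono[OF eventually_at_right_less])
qed

text \<open>So \<open>u \<mapsto> (w - cnj w * u) / (1 - u)\<close> maps the unit disc into the half plane of \<open>w\<close>, with \<open>0 \<mapsto> w\<close>.\<close>
lemma Im_Cayley:
  assumes "norm u < 1"
  shows "Im ((w - cnj w * u) / (1 - u)) = Im w * (1 - (norm u)\<^sup>2) / (norm (1 - u))\<^sup>2"
proof -
  have "u \<noteq> 1" using assms by auto
  have "Im ((w - cnj w * u) * cnj (1 - u)) = Im w * (1 - (norm u)\<^sup>2)"
    unfolding cmod_power2 by (simp add: power2_eq_square algebra_simps)
  then show ?thesis
    by (subst complex_div_cnj) (simp only: of_real_power[symmetric] Im_divide_of_real)
qed

text \<open>
  The hypothesis on \<open>K\<close> says that each coordinate of \<open>z\<close> has pseudohyperbolic distance at most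
  \<open>\<rho> = sqrt (K / (4 + K))\<close> from that of \<open>w\<close>. Hence there is an analytic disc in \<open>\<Pi>\<^sup>n\<close> that passes
  through \<open>w\<close> at \<open>0\<close> and through \<open>z\<close> at \<open>\<rho>\<close>, and the one-variable inequality applies to \<open>h\<close> on it.
\<close>
lemma Schwarz_Pick_upper_poly_half_plane:
  fixes h :: "complex ^ 'n \<Rightarrow> complex"
  assumes h: "h multi_analytic_on upper_poly_half_plane"
    and Im: "\<And>z. z \<in> upper_poly_half_plane \<Longrightarrow> Im (h z) \<ge> 0"
    and z: "z \<in> upper_poly_half_plane" and w: "w \<in> upper_poly_half_plane"
    and K: "\<And>j. (norm (z $ j - w $ j))\<^sup>2 \<le> K * Im (z $ j) * Im (w $ j)"
  shows "(norm (h z - h w))\<^sup>2 \<le> K * Im (h z) * Im (h w)"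
proof -
  have pos: "Im (z $ j) > 0" "Im (w $ j) > 0" for j
    using z w by (auto simp: upper_poly_half_plane_def upper_half_plane_def)
  have "0 \<le> K * (Im (z $ j) * Im (w $ j))" for j
    using K[of j] by (simp add: mult.assoc) (meson order_trans zero_le_power2)
  then have "K \<ge> 0"
    using pos by (meson mult_pos_pos zero_le_mult_iff not_less)
  then consider "K = 0" | "K > 0" by fastforce
  then show ?thesis
  proof cases
    case 1
    then have "z = w" using K by (simp add: vec_eq_iff)
    with 1 show ?thesis by simp
  next
    case 2
    define \<rho> where "\<rho> = sqrt (K / (4 + K))"
    have \<rho>: "0 < \<rho>" "\<rho> < 1" "\<rho>\<^sup>2 = K / (4 + K)"
      using 2 by (simp_all add: \<rho>_def)
    \<comment> \<open>The Cayley transform of the j-th half plane that sends w j to 0 sends z j to \<mu> j. The disc is the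
      preimage of the linear disc whose j-th coordinate is \<zeta> * \<mu> j / \<rho>.\<close>
    define \<mu> where "\<mu> = (\<lambda>j. (z $ j - w $ j) / (z $ j - cnj (w $ j)))"
    have nz: "z $ j - cnj (w $ j) \<noteq> 0" for j
      using pos[of j] by (auto simp: complex_eq_iff)
    have \<mu>: "norm (\<mu> j) \<le> \<rho>" for j
    proof (rule power2_le_imp_le)
      have "(4 + K) * (norm (z $ j - w $ j))\<^sup>2 \<le> K * (norm (z $ j - cnj (w $ j)))\<^sup>2"
        unfolding norm_diff_cnj_power2 using K[of j] by (simp add: algebra_simps)
      then show "(norm (\<mu> j))\<^sup>2 \<le> \<rho>\<^sup>2"
        using 2 nz[of j] by (simp add: \<mu>_def \<rho> norm_divide power_divide divide_simps mult.commute)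
    qed (use \<rho> in auto)
    define \<psi> where "\<psi> = (\<lambda>\<zeta>. \<chi> j. (w $ j - cnj (w $ j) * (\<zeta> * (\<mu> j / \<rho>))) / (1 - \<zeta> * (\<mu> j / \<rho>)))"
    have small: "norm (\<zeta> * (\<mu> j / \<rho>)) < 1" if "norm \<zeta> < 1" for \<zeta> j
    proof -
      have "norm (\<zeta> * (\<mu> j / \<rho>)) \<le> norm \<zeta> * 1"
        unfolding norm_mult using \<mu>[of j] \<rho> by (intro mult_left_mono) (auto simp: norm_divide)
      with that show ?thesis by simp
    qed
    have \<psi>: "\<psi> \<zeta> \<in> upper_poly_half_plane" if "norm \<zeta> < 1" for \<zeta>
    proof -
      have "Im (\<psi> \<zeta> $ j) > 0" for j
      proof -
        have "1 - (norm (\<zeta> * (\<mu> j / \<rho>)))\<^sup>2 > 0" and "1 - \<zeta> * (\<mu> j / \<rho>) \<noteq> 0"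
          using small[OF that, of j] by (auto simp: power_less_one_iff abs_square_less_1)
        then show ?thesis
          using pos(2)[of j] small[OF that, of j] by (simp only: \<psi>_def vec_lambda_beta Im_Cayley) simp
      qed
      then show ?thesis by (simp add: upper_poly_half_plane_def upper_half_plane_def)
    qed
    have "(\<lambda>\<zeta>. h (\<psi> \<zeta>)) holomorphic_on ball 0 1"
    proof (rule holomorphic_on_compose_multi_analytic[OF h])
      show "(\<lambda>\<zeta>. \<psi> \<zeta> $ j) holomorphic_on ball 0 1" for j
      proof -
        have "1 - \<zeta> * (\<mu> j / \<rho>) \<noteq> 0" if "norm \<zeta> < 1" for \<zeta>
          using small[OF that, of j] by auto
        then show ?thesis
          unfolding \<psi>_def vec_lambda_beta using \<rho> by (intro holomorphic_intros) auto
      qed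
    qed (use \<psi> in auto)
    then have "(1 - (norm (of_real \<rho> :: complex))\<^sup>2) * (norm (h (\<psi> \<rho>) - h (\<psi> 0)))\<^sup>2
        \<le> 4 * (norm (of_real \<rho> :: complex))\<^sup>2 * Im (h (\<psi> \<rho>)) * Im (h (\<psi> 0))"
      using \<rho> by (intro Schwarz_Pick_disc_half_plane Im \<psi>) auto
    moreover have "\<psi> 0 = w"
      by (simp add: \<psi>_def vec_eq_iff)
    moreover have "\<psi> \<rho> = z"
    proof -
      have "\<psi> \<rho> $ j = z $ j" for j
      proof -
        have ne: "w $ j - cnj (w $ j) \<noteq> 0" using pos[of j] by (auto simp: complex_eq_iff)
        have "\<psi> \<rho> $ j = (w $ j - cnj (w $ j) * \<mu> j) / (1 - \<mu> j)"
          using \<rho> by (simp add: \<psi>_def)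
        also have "\<dots> = (z $ j * (w $ j - cnj (w $ j)) / (z $ j - cnj (w $ j)))
             / ((w $ j - cnj (w $ j)) / (z $ j - cnj (w $ j)))"
          using nz[of j] by (intro arg_cong2[where f = "(/)"]) (auto simp: \<mu>_def field_simps)
        also have "\<dots> = z $ j" using nz[of j] ne by simp
        finally show ?thesis .
      qed
      then show ?thesis by (simp add: vec_eq_iff)
    qed
    ultimately have "(1 - K / (4 + K)) * (norm (h z - h w))\<^sup>2 \<le> 4 * (K / (4 + K)) * Im (h z) * Im (h w)"
      using \<rho> by simp
    moreover have "1 - K / (4 + K) = 4 / (4 + K)"
      using 2 by (simp add: field_simps)
    ultimately have "4 / (4 + K) * (norm (h z - h w))\<^sup>2 \<le> 4 / (4 + K) * (K * Im (h z) * Im (h w))"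
      by (simp add: mult_ac)
    then show ?thesis
      using 2 by (subst (asm) mult_le_cancel_left_pos) auto
  qed
qed

section \<open>Julia's lemma along rays into the boundary point\<close>

definition ray :: "real ^ 'n \<Rightarrow> real ^ 'n \<Rightarrow> real \<Rightarrow> complex ^ 'n" where
  "ray p v s = complex_vec p + (\<i> * complex_of_real s) *s complex_vec v"

lemma ray_component: "ray p v s $ j = complex_of_real (p $ j) + \<i> * complex_of_real (s * v $ j)"
  by (simp add: ray_def complex_vec_def)

lemma ray_in_upper_poly_half_plane:
  "(\<And>j. v $ j > 0) \<Longrightarrow> s > 0 \<Longrightarrow> ray p v s \<in> upper_poly_half_plane"
  by (simp add: upper_poly_half_plane_def upper_half_plane_def ray_component)

lemma pick_class_Im_nonneg:
  assumes "h \<in> pick_class E" and "z \<in> upper_poly_half_plane"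
  shows "Im (h z) \<ge> 0"
proof -
  have "closure upper_half_plane \<subseteq> {z. Im z \<ge> 0}"
    by (intro closure_minimal closed_halfspace_Im_ge) (auto simp: upper_half_plane_def)
  then show ?thesis
    using assms by (auto simp: pick_class_def)
qed

lemma pick_class_tendsto_along_ray:
  fixes h :: "complex ^ 'n \<Rightarrow> complex"
  assumes h: "h \<in> pick_class {p}" and v: "\<And>j. v $ j > 0"
  shows "((\<lambda>t. h (ray p v t)) \<longlongrightarrow> h (complex_vec p)) (at_right 0)"
proof (rule continuous_on_tendsto_compose[where f = h and g = "ray p v"])
  show "continuous_on (upper_poly_half_plane \<union> complex_vec ` {p}) h"
    using h by (simp add: pick_class_def)
  have "((\<lambda>t. complex_of_real (p $ j) + \<i> * complex_of_real (t * v $ j)) \<longlongrightarrow>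
      complex_of_real (p $ j) + \<i> * complex_of_real (0 * v $ j)) (at_right 0)" for j
    by (intro tendsto_intros)
  then show "(ray p v \<longlongrightarrow> complex_vec p) (at_right 0)"
    by (intro vec_tendstoI) (simp add: ray_component complex_vec_def)
  show "\<forall>\<^sub>F t in at_right 0. ray p v t \<in> upper_poly_half_plane \<union> complex_vec ` {p}"
    using ray_in_upper_poly_half_plane[OF v]
    by (auto intro!: eventually_mono[OF eventually_at_right_less])
qed simp

text \<open>
  Schwarz--Pick between \<open>p + isy\<close> and \<open>p + itv\<close> for \<open>t\<close> tending to \<open>0\<close>. It is enough that the bound on
  \<open>Im h\<close> holds for arbitrarily small \<open>t\<close>: the two sides of the inequality converge as \<open>t\<close> tends to \<open>0\<close>, so
  a strict violation in the limit would exclude the bound for all small \<open>t\<close>.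
\<close>
lemma Julia_along_rays:
  fixes h :: "complex ^ 'n \<Rightarrow> complex"
  assumes h: "h \<in> pick_class {p}" and v: "\<And>j. v $ j > 0" and y: "\<And>j. y $ j > 0"
    and B: "\<And>j. y $ j \<le> B * v $ j"
    and A: "\<exists>\<^sub>F t in at_right 0. Im (h (ray p v t)) \<le> A * t" and s: "s > 0"
  shows "(norm (h (ray p y s) - h (complex_vec p)))\<^sup>2 \<le> Im (h (ray p y s)) * (A * B * s)"
proof (rule ccontr)
  let ?I = "Im (h (ray p y s))"
  define C where "C = (\<Sum>j\<in>UNIV. v $ j / (s * y $ j))"
  have I: "?I \<ge> 0"
    using pick_class_Im_nonneg[OF h] ray_in_upper_poly_half_plane[OF y s] by blast
  have C: "v $ j / (s * y $ j) \<le> C" for j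
    unfolding C_def using v y s by (intro member_le_sum) (auto simp: less_imp_le)
  have SP: "(norm (h (ray p y s) - h (ray p v t)))\<^sup>2 \<le> ?I * ((s * B + t\<^sup>2 * C) * A)"
    if t: "t > 0" and A: "Im (h (ray p v t)) \<le> A * t" for t
  proof -
    \<comment> \<open>With a = s * y j and b = t * v j one has (a - b)^2 / (a * b) \<le> a / b + b / a, whose first term is
      at most s * B / t and whose second is at most t * C. After multiplication by A * t only
      s * B * A survives in the limit.\<close>
    define K where "K = s * B / t + t * C"
    have K: "s * y $ j / (t * v $ j) + t * v $ j / (s * y $ j) \<le> K" for j
    proof -
      have "s * y $ j / (t * v $ j) \<le> s * B / t"
        using B[of j] v[of j] s t by (simp add: field_simps)
      moreover have "t * v $ j / (s * y $ j) \<le> t * C"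
        using mult_left_mono[OF C[of j], of t] t by simp
      ultimately show ?thesis by (simp add: K_def)
    qed
    have K0: "K \<ge> 0"
    proof -
      fix j :: 'n
      have "0 \<le> s * y $ j / (t * v $ j) + t * v $ j / (s * y $ j)"
        using v[of j] y[of j] s t by simp
      then show ?thesis using K[of j] by simp
    qed
    have sum_squares: "a\<^sup>2 + b\<^sup>2 = (a / b + b / a) * (a * b)" if "a > 0" "b > 0" for a b :: real
      using that by (simp add: field_simps power2_eq_square)
    have "(norm (h (ray p y s) - h (ray p v t)))\<^sup>2 \<le> K * ?I * Im (h (ray p v t))"
    proof (rule Schwarz_Pick_upper_poly_half_plane)
      show "h multi_analytic_on upper_poly_half_plane" using h by (simp add: pick_class_def)
      fix j
      let ?a = "s * y $ j" and ?b = "t * v $ j"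
      have ab: "?a > 0" "?b > 0" using s t v y by simp_all
      have "(norm (ray p y s $ j - ray p v t $ j))\<^sup>2 = (?a - ?b)\<^sup>2"
        by (simp add: ray_component cmod_power2)
      also have "\<dots> \<le> ?a\<^sup>2 + ?b\<^sup>2"
        using mult_pos_pos[OF ab] by (simp add: power2_eq_square algebra_simps)
      also have "\<dots> = (?a / ?b + ?b / ?a) * (?a * ?b)"
        using sum_squares[OF ab] .
      also have "\<dots> \<le> K * (?a * ?b)"
        using K[of j] ab by (intro mult_right_mono) auto
      finally show "(norm (ray p y s $ j - ray p v t $ j))\<^sup>2 \<le> K * Im (ray p y s $ j) * Im (ray p v t $ j)"
        by (simp add: ray_component mult.assoc)
    qed (use pick_class_Im_nonneg[OF h] ray_in_upper_poly_half_plane v y s t in auto)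
    also have "\<dots> \<le> K * ?I * (A * t)"
      using A K0 I by (intro mult_left_mono) auto
    also have "\<dots> = ?I * ((s * B + t\<^sup>2 * C) * A)"
      using t by (simp add: K_def field_simps power2_eq_square)
    finally show ?thesis .
  qed
  assume "\<not> ?thesis"
  then have less: "?I * ((s * B + 0\<^sup>2 * C) * A) < (norm (h (ray p y s) - h (complex_vec p)))\<^sup>2"
    by (simp add: mult_ac)
  have "((\<lambda>t. (norm (h (ray p y s) - h (ray p v t)))\<^sup>2 - ?I * ((s * B + t\<^sup>2 * C) * A)) \<longlongrightarrow>
      (norm (h (ray p y s) - h (complex_vec p)))\<^sup>2 - ?I * ((s * B + 0\<^sup>2 * C) * A)) (at_right 0)"
    by (intro tendsto_intros pick_class_tendsto_along_ray[OF h v])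
  then have "\<forall>\<^sub>F t in at_right 0. 0 < (norm (h (ray p y s) - h (ray p v t)))\<^sup>2 - ?I * ((s * B + t\<^sup>2 * C) * A)"
    using less by (intro order_tendstoD(1)) auto
  with eventually_at_right_less[of 0] have "\<forall>\<^sub>F t in at_right 0. \<not> Im (h (ray p v t)) \<le> A * t"
    by eventually_elim (use SP in fastforce)
  then show False using A by (simp add: frequently_def)
qed

text \<open>
  Since \<open>h p\<close> is real, \<open>Im (h (p + isy))\<close> is at most the distance of \<open>h (p + isy)\<close> from \<open>h p\<close>, so that
  one factor of the square cancels.
\<close>
lemma Julia_along_rays_linear:
  fixes h :: "complex ^ 'n \<Rightarrow> complex"
  assumes h: "h \<in> pick_class {p}" and real: "h (complex_vec p) \<in> \<real>"
    and v: "\<And>j. v $ j > 0" and y: "\<And>j. y $ j > 0" and B: "\<And>j. y $ j \<le> B * v $ j"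
    and A: "\<exists>\<^sub>F t in at_right 0. Im (h (ray p v t)) \<le> A * t" and s: "s > 0"
  shows "norm (h (ray p y s) - h (complex_vec p)) \<le> A * B * s"
proof -
  let ?d = "norm (h (ray p y s) - h (complex_vec p))"
  obtain t where t: "t > 0" "Im (h (ray p v t)) \<le> A * t"
    using frequently_eventually_frequently[OF A eventually_at_right_less[of 0]]
    by (auto dest: frequently_ex)
  have "0 \<le> Im (h (ray p v t))"
    by (intro pick_class_Im_nonneg[OF h] ray_in_upper_poly_half_plane v t)
  then have "0 \<le> A * t"
    using t by linarith
  then have "A \<ge> 0" using t(1) by (simp add: zero_le_mult_iff)
  moreover have "B \<ge> 0"
  proof -
    fix j :: 'n
    have "0 < B * v $ j" using B[of j] y[of j] by linarith
    then show ?thesis using v[of j] by (simp add: zero_less_mult_iff)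
  qed
  ultimately have nonneg: "0 \<le> A * B * s" using s by simp
  have "Im (h (ray p y s)) \<le> ?d"
    using abs_Im_le_cmod[of "h (ray p y s) - h (complex_vec p)"] real
    by (simp add: complex_is_Real_iff)
  then have "?d * ?d \<le> ?d * (A * B * s)"
    using Julia_along_rays[OF h v y B A s] nonneg
    by (simp add: power2_eq_square) (meson mult_right_mono order_trans)
  then show ?thesis
    using nonneg by (cases "?d = 0") (auto simp: mult_le_cancel_left)
qed

section \<open>The directional derivative in a direction of bounded growth\<close>

lemma dir_quotient_ray:
  "dir_quotient h p v s = (h (ray p v s) - h (complex_vec p)) / (\<i> * complex_of_real s)"
  by (simp add: dir_quotient_def ray_def)

text \<open>
  The derivative is the supremum \<open>\<alpha>\<close> of \<open>\<bar>h (p + itv) - h p\<bar> / t\<close>. Julia's lemma shows that \<open>\<alpha>\<close> is at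
  most every \<open>A\<close> that bounds \<open>Im h (p + itv) / t\<close> for arbitrarily small \<open>t\<close>, while these quotients never
  exceed \<open>\<alpha>\<close>; hence they converge to \<open>\<alpha>\<close>. The quadratic form of Julia's lemma with \<open>A = \<alpha>\<close> leaves no
  room for a real part: \<open>(Re / t)\<^sup>2 \<le> q (\<alpha> - q)\<close> with \<open>q = Im / t\<close> tending to \<open>\<alpha>\<close>.
\<close>
lemma Caratheodory_along_ray:
  fixes h :: "complex ^ 'n \<Rightarrow> complex"
  assumes h: "h \<in> pick_class {p}" and real: "h (complex_vec p) \<in> \<real>" and v: "\<And>j. v $ j > 0"
    and bounded: "\<exists>\<^sub>F t in at_right 0. Im (h (ray p v t)) \<le> A * t"
  obtains \<alpha> :: real where "(dir_quotient h p v \<longlongrightarrow> complex_of_real \<alpha>) (at_right 0)"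
    and "\<And>t. t > 0 \<Longrightarrow> Im (h (ray p v t)) \<le> \<alpha> * t"
proof
  define \<phi> where "\<phi> = (\<lambda>t. h (ray p v t) - h (complex_vec p))"
  define \<alpha> where "\<alpha> = (SUP t\<in>{0<..}. norm (\<phi> t) / t)"
  define q where "q = (\<lambda>t. Im (\<phi> t) / t)"
  have Im: "Im (\<phi> t) = Im (h (ray p v t))" for t
    using real by (simp add: \<phi>_def complex_is_Real_iff)
  have le: "norm (\<phi> t) / t \<le> A'"
    if "\<exists>\<^sub>F t in at_right 0. Im (h (ray p v t)) \<le> A' * t" "t > 0" for A' t
    using Julia_along_rays_linear[OF h real v v _ that, of 1] that(2)
    by (simp add: \<phi>_def field_simps)
  have bdd: "bdd_above ((\<lambda>t. norm (\<phi> t) / t) ` {0<..})"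
    using le[OF bounded] by (auto intro!: bdd_aboveI2)
  have norm_le: "norm (\<phi> t) / t \<le> \<alpha>" if "t > 0" for t
    unfolding \<alpha>_def using that by (intro cSUP_upper bdd) auto
  have q_le: "q t \<le> \<alpha>" if "t > 0" for t
  proof -
    have "q t \<le> norm (\<phi> t) / t"
      using that abs_Im_le_cmod[of "\<phi> t"] by (simp add: q_def divide_right_mono)
    with norm_le[OF that] show ?thesis by simp
  qed
  then show Im_le: "Im (h (ray p v t)) \<le> \<alpha> * t" if "t > 0" for t
    using that by (fastforce simp: q_def Im field_simps)
  have q: "(q \<longlongrightarrow> \<alpha>) (at_right 0)"
  proof (rule order_tendstoI)
    fix a assume "a < \<alpha>"
    show "\<forall>\<^sub>F t in at_right 0. a < q t"
    proof (rule ccontr)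
      assume "\<not> (\<forall>\<^sub>F t in at_right 0. a < q t)"
      then have "\<exists>\<^sub>F t in at_right 0. q t \<le> a"
        by (simp add: frequently_def not_le)
      from frequently_eventually_frequently[OF this eventually_at_right_less]
      have "\<exists>\<^sub>F t in at_right 0. Im (h (ray p v t)) \<le> a * t"
        by (rule frequently_elim1) (auto simp: q_def Im field_simps)
      from le[OF this] have "\<alpha> \<le> a"
        unfolding \<alpha>_def by (intro cSUP_least) auto
      with \<open>a < \<alpha>\<close> show False by simp
    qed
  next
    fix a assume "\<alpha> < a"
    then show "\<forall>\<^sub>F t in at_right 0. q t < a"
      using q_le by (auto intro!: eventually_mono[OF eventually_at_right_less] dest: order_le_less_trans)
  qed
  have freq: "\<exists>\<^sub>F t in at_right 0. Im (h (ray p v t)) \<le> \<alpha> * t"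
    by (intro eventually_frequently eventually_mono[OF eventually_at_right_less] Im_le) auto
  have Re_le: "(Re (\<phi> t) / t)\<^sup>2 \<le> q t * (\<alpha> - q t)" if t: "t > 0" for t
  proof -
    have "(norm (\<phi> t))\<^sup>2 \<le> Im (\<phi> t) * (\<alpha> * t)"
      using Julia_along_rays[OF h v v _ freq t, of 1] by (simp add: Im \<phi>_def[symmetric])
        (simp add: \<phi>_def)
    then have "(Re (\<phi> t))\<^sup>2 \<le> Im (\<phi> t) * (\<alpha> * t) - (Im (\<phi> t))\<^sup>2"
      by (simp add: cmod_power2)
    then have "(Re (\<phi> t))\<^sup>2 / t\<^sup>2 \<le> (Im (\<phi> t) * (\<alpha> * t) - (Im (\<phi> t))\<^sup>2) / t\<^sup>2"
      by (rule divide_right_mono) simp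
    also have "\<dots> = q t * (\<alpha> - q t)"
      using t by (simp add: q_def field_simps power2_eq_square)
    finally show ?thesis by (simp add: power_divide)
  qed
  have "((\<lambda>t. q t * (\<alpha> - q t)) \<longlongrightarrow> \<alpha> * (\<alpha> - \<alpha>)) (at_right 0)"
    by (intro tendsto_intros q)
  then have lim: "((\<lambda>t. q t * (\<alpha> - q t)) \<longlongrightarrow> 0) (at_right 0)"
    by simp
  have "\<forall>\<^sub>F t in at_right 0. (Re (\<phi> t) / t)\<^sup>2 \<le> q t * (\<alpha> - q t)"
    using eventually_at_right_less by (rule eventually_mono) (rule Re_le)
  then have "((\<lambda>t. (Re (\<phi> t) / t)\<^sup>2) \<longlongrightarrow> 0) (at_right 0)"
    by (intro tendsto_sandwich[OF always_eventually _ tendsto_const lim]) simp_all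
  then have Re: "((\<lambda>t. Re (\<phi> t) / t) \<longlongrightarrow> 0) (at_right 0)"
    by simp
  have "((\<lambda>t. Complex (q t) (- (Re (\<phi> t) / t))) \<longlongrightarrow> Complex \<alpha> (- 0)) (at_right 0)"
    by (intro tendsto_Complex tendsto_minus q Re)
  moreover have "\<forall>\<^sub>F t in at_right 0. Complex (q t) (- (Re (\<phi> t) / t)) = dir_quotient h p v t"
  proof (rule eventually_mono[OF eventually_at_right_less])
    fix t :: real assume "0 < t"
    then have "Complex (q t) (- (Re (\<phi> t) / t)) = \<phi> t / (\<i> * complex_of_real t)"
      by (subst nonzero_eq_divide_eq) (auto simp: complex_eq_iff q_def)
    then show "Complex (q t) (- (Re (\<phi> t) / t)) = dir_quotient h p v t"
      by (simp add: dir_quotient_ray \<phi>_def)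
  qed
  ultimately show "(dir_quotient h p v \<longlongrightarrow> complex_of_real \<alpha>) (at_right 0)"
    by (auto simp: complex_of_real_def elim: Lim_transform_eventually)
qed

section \<open>Comparison of the directions\<close>

theorem theorem4p1:
  fixes p x :: "real ^ 'n" and h :: "complex ^ 'n \<Rightarrow> complex"
  assumes "h \<in> pick_class {p}"
    and "h (complex_vec p) \<in> \<real>"
    and "\<And>j. x $ j > 0"
    and "has_dir_deriv h p x"
  shows "has_dir_deriv h p 1 \<and>
         dir_deriv h p 1 \<in> \<real> \<and>
         norm (dir_deriv h p x) \<le> infnorm x * Re (dir_deriv h p 1)"
proof -
  note h = assms(1) and real = assms(2) and x = assms(3)
  have one: "(1 :: real ^ 'n) $ j > 0" for j by simp
  obtain D where D: "(dir_quotient h p x \<longlongrightarrow> D) (at_right 0)"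
    using assms(4) by (auto simp: has_dir_deriv_def)
  have norm_quotient: "norm (dir_quotient h p v t) = norm (h (ray p v t) - h (complex_vec p)) / t"
    if "t > 0" for v t
    using that by (simp add: dir_quotient_ray norm_divide norm_mult)
  have Im_le: "Im (h (ray p v t)) \<le> norm (h (ray p v t) - h (complex_vec p))" for v t
    using abs_Im_le_cmod[of "h (ray p v t) - h (complex_vec p)"] real
    by (simp add: complex_is_Real_iff)

  \<comment> \<open>Differentiability along x makes Im h grow at most linearly along x, hence along 1.\<close>
  have "\<forall>\<^sub>F t in at_right 0. norm (dir_quotient h p x t) < norm D + 1"
    using tendsto_norm[OF D] by (rule order_tendstoD(2)) simp
  with eventually_at_right_less[of 0]
  have "\<forall>\<^sub>F t in at_right 0. Im (h (ray p x t)) \<le> (norm D + 1) * t"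
  proof eventually_elim
    case (elim t)
    then have "norm (h (ray p x t) - h (complex_vec p)) \<le> (norm D + 1) * t"
      by (simp add: norm_quotient field_simps)
    then show ?case using Im_le[of x t] by simp
  qed
  then have freq_x: "\<exists>\<^sub>F t in at_right 0. Im (h (ray p x t)) \<le> (norm D + 1) * t"
    by (intro eventually_frequently) auto
  define B where "B = (\<Sum>j\<in>UNIV. 1 / x $ j)"
  have B: "(1 :: real ^ 'n) $ j \<le> B * x $ j" for j
  proof -
    have "1 / x $ j \<le> B"
      unfolding B_def using x by (intro member_le_sum) (auto simp: less_imp_le)
    then show ?thesis using x[of j] by (simp add: field_simps)
  qed
  have "Im (h (ray p 1 t)) \<le> (norm D + 1) * B * t" if "t > 0" for t
    using Julia_along_rays_linear[OF h real x one B freq_x that] Im_le[of 1 t] by simp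
  then have "\<exists>\<^sub>F t in at_right 0. Im (h (ray p 1 t)) \<le> (norm D + 1) * B * t"
    by (intro eventually_frequently eventually_mono[OF eventually_at_right_less]) auto
  then obtain \<alpha> where \<alpha>: "(dir_quotient h p 1 \<longlongrightarrow> complex_of_real \<alpha>) (at_right 0)"
    and Im_\<alpha>: "\<And>t. t > 0 \<Longrightarrow> Im (h (ray p 1 t)) \<le> \<alpha> * t"
    using Caratheodory_along_ray[OF h real one] by blast

  \<comment> \<open>Back from direction 1 to direction x, now with the exact constant \<alpha>.\<close>
  have "\<exists>\<^sub>F t in at_right 0. Im (h (ray p 1 t)) \<le> \<alpha> * t"
    by (intro eventually_frequently eventually_mono[OF eventually_at_right_less] Im_\<alpha>) auto
  moreover have "x $ j \<le> infnorm x * (1 :: real ^ 'n) $ j" for j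
    using component_le_infnorm_cart[of x j] by simp
  ultimately have "norm (dir_quotient h p x s) \<le> infnorm x * \<alpha>" if "s > 0" for s
    using Julia_along_rays_linear[OF h real one x _ _ that, of "infnorm x" \<alpha>] that
    by (simp add: norm_quotient field_simps)
  then have "norm D \<le> infnorm x * \<alpha>"
    by (intro tendsto_upperbound[OF tendsto_norm[OF D]])
      (auto intro!: eventually_mono[OF eventually_at_right_less])
  moreover have "dir_deriv h p 1 = complex_of_real \<alpha>" "dir_deriv h p x = D"
    using \<alpha> D by (auto simp: dir_deriv_def intro!: tendsto_Lim)
  ultimately show ?thesis
    using \<alpha> by (auto simp: has_dir_deriv_def)
qed

end
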